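(* Let $k\leqslant 2$ and $n>k$ be natural numbers. Then every graph $G$ on $n$ vertices satisfies $h_k(G)\geqslant f_0(n,k)$.
   Context: All graphs are finite, undirected, without loops or multiple edges. For a graph $G$ and a natural number $k$, $h_k(G)$ denotes the number of unordered pairs of distinct vertices of $G$ whose degrees differ by less than $k$. For natural numbers $n>k$, $$f_0(n,k):=\left(\left\lceil \tfrac{n}{k} \right\rceil - 2\right)\binom{k}{2} + \binom{k+1}{2} + \binom{n-k \left( \left\lceil\frac{n}{k} \right\rceil - 1 \right)-1}{2},$$ where $\binom{m}{2}=m(m-1)/2$. *)

theory Defs
  imports Complex_Main
begin

definition simple_graph :: "'a set \<Rightarrow> 'a set set \<Rightarrow> bool" where
  "simple_graph V E \<longleftrightarrow> finite V \<and> E \<subseteq> {e. e \<subseteq> V \<and> card e = 2}"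

definition degree :: "'a set set \<Rightarrow> 'a \<Rightarrow> nat" where
  "degree E v = card {e \<in> E. v \<in> e}"

text \<open>Pairs are taken as two-element sets, so each unordered pair is counted once.\<close>

definition h :: "nat \<Rightarrow> 'a set \<Rightarrow> 'a set set \<Rightarrow> nat" where
  "h k V E = card {{u, v} | u v. u \<in> V \<and> v \<in> V \<and> u \<noteq> v \<and>
     \<bar>int (degree E u) - int (degree E v)\<bar> < int k}"

text \<open>Real arithmetic avoids truncated subtraction;
  \<open>m gchoose 2 = m * (m - 1) / 2\<close> for every real \<open>m\<close>.\<close>

definition f0 :: "nat \<Rightarrow> nat \<Rightarrow> real" where
  "f0 n k = (of_int \<lceil>real n / real k\<rceil> - 2) * (real k gchoose 2) + (real (k + 1) gchoose 2)
     + ((real n - real k * (of_int \<lceil>real n / real k\<rceil> - 1) - 1) gchoose 2)"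

end

theory Submission
  imports Defs
begin

text \<open>
  Group the vertices into buckets such that degrees in the same bucket differ by less than \<open>k\<close>.
  A bucket with \<open>a\<close> vertices contributes \<open>a choose 2\<close> pairs, and \<open>a choose 2\<close> is at least both
  \<open>a - 1\<close> and \<open>2 * a - 3\<close>. Since degrees \<open>0\<close> and \<open>n - 1\<close> cannot both occur, one of them can be left
  out; for \<open>k = 1\<close>, and for \<open>k = 2\<close> with \<open>n\<close> odd, the two bounds then suffice. For \<open>k = 2\<close> and
  \<open>n = 2 * m\<close>, the buckets \<open>{2 * j, 2 * j + 1}\<close> give \<open>m\<close> pairs, one too few. If there were no more
  pairs, every bucket would contain exactly two vertices and no close pair would join two buckets.
  A vertex of degree \<open>0\<close> would then force the other vertex of the lowest bucket to be adjacent to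
  both vertices of the highest one. So the lowest bucket consists of odd degrees; hence so does each
  following one, and the two vertices of degree \<open>n - 1\<close> contradict the two of degree \<open>1\<close>.
\<close>

section \<open>Values of the lower bound for \<open>k = 1\<close> and \<open>k = 2\<close>\<close>

lemma gchoose_two: "(x::real) gchoose 2 = x * (x - 1) / 2"
  by (simp add: numeral_2_eq_2 gbinomial_Suc atLeast0_atMost_Suc)

lemma f0_one: "1 < n \<Longrightarrow> f0 n 1 = 1"
  by (simp add: f0_def gchoose_two)

text \<open>The ceiling is \<open>m\<close> and the last binomial is 1 choose 2, which vanishes;
  what remains is (m - 2) + 3.\<close>

lemma f0_two_even: "f0 (2 * m) 2 = real m + 1"
  by (simp add: f0_def gchoose_two)

lemma f0_two_odd: "f0 (2 * m + 1) 2 = real m + 2"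
proof -
  have "\<lceil>real (2 * m + 1) / real 2\<rceil> = int m + 1"
    by (rule ceiling_unique) (auto simp: field_simps)
  then show ?thesis
    by (simp add: f0_def gchoose_two)
qed

section \<open>Counting pairs inside buckets\<close>

lemma choose_two_Suc: "Suc a choose 2 = a + (a choose 2)"
  by (simp add: numeral_2_eq_2)

lemma le_choose_two_add_1: "a \<le> (a choose 2) + 1"
  by (induction a) (auto simp: choose_two_Suc)

text \<open>Among natural numbers, equality holds only at 2 and 3, while
  \<open>a \<le> (a choose 2) + 1\<close> is sharp only at 1 and 2. So 2 is the only size at which
  both bounds are sharp.\<close>

lemma double_le_choose_two_add_3: "2 * a \<le> (a choose 2) + 3"
proof (induction a)
  case (Suc a)
  show ?case
  proof (cases "a \<le> 1")
    case True
    then show ?thesis by (auto simp: le_Suc_eq choose_two_Suc)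
  next
    case False
    with Suc show ?thesis by (simp add: choose_two_Suc)
  qed
qed simp

lemma sum_card_fibres:
  assumes "finite V" "finite S" "b ` V \<subseteq> S"
  shows "(\<Sum>s\<in>S. card {v \<in> V. b v = s}) = card V"
  using sum.group[OF assms, of "\<lambda>_. 1::nat"] by simp

lemma sum_choose_two_ge:
  assumes "finite V" "finite S" "b ` V \<subseteq> S"
  defines "c \<equiv> \<lambda>s. card {v \<in> V. b v = s} choose 2"
  shows "card V \<le> (\<Sum>s\<in>S. c s) + card S"
    and "2 * card V \<le> (\<Sum>s\<in>S. c s) + 3 * card S"
proof -
  let ?a = "\<lambda>s. card {v \<in> V. b v = s}"
  have "(\<Sum>s\<in>S. ?a s) \<le> (\<Sum>s\<in>S. c s + 1)"
    unfolding c_def by (intro sum_mono le_choose_two_add_1)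
  then show "card V \<le> (\<Sum>s\<in>S. c s) + card S"
    by (simp only: sum_card_fibres[OF assms(1-3)] sum.distrib) simp
  have "(\<Sum>s\<in>S. 2 * ?a s) \<le> (\<Sum>s\<in>S. c s + 3)"
    unfolding c_def by (intro sum_mono double_le_choose_two_add_3)
  then show "2 * card V \<le> (\<Sum>s\<in>S. c s) + 3 * card S"
    by (simp only: sum_card_fibres[OF assms(1-3)] sum.distrib sum_distrib_left[symmetric]) simp
qed

text \<open>With mean bucket size 2 and the least possible sum, both linear bounds are equalities
  after summation, hence equalities in every bucket.\<close>

lemma card_fibre_eq_2:
  assumes "finite V" "finite S" "b ` V \<subseteq> S" "card V = 2 * card S"
    and sum: "(\<Sum>s\<in>S. card {v \<in> V. b v = s} choose 2) = card S" and "s \<in> S"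
  shows "card {v \<in> V. b v = s} = 2"
proof -
  let ?a = "\<lambda>s. card {v \<in> V. b v = s}"
  have tot: "(\<Sum>s\<in>S. ?a s) = 2 * card S"
    using sum_card_fibres[OF assms(1-3)] assms(4) by simp
  have eq1: "?a s = (?a s choose 2) + 1"
  proof (rule sum_mono_inv[of ?a S "\<lambda>s. (?a s choose 2) + 1" s])
    show "(\<Sum>s\<in>S. ?a s) = (\<Sum>s\<in>S. (?a s choose 2) + 1)"
      by (simp only: tot sum.distrib sum) simp
  qed (use assms le_choose_two_add_1 in auto)
  have eq2: "2 * ?a s = (?a s choose 2) + 3"
  proof (rule sum_mono_inv[of "\<lambda>s. 2 * ?a s" S "\<lambda>s. (?a s choose 2) + 3" s])
    show "(\<Sum>s\<in>S. 2 * ?a s) = (\<Sum>s\<in>S. (?a s choose 2) + 3)"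
      by (simp only: sum.distrib sum sum_distrib_left[symmetric] tot) simp
  qed (use assms double_le_choose_two_add_3 in auto)
  \<comment> \<open>Subtracting \<open>eq1\<close> from \<open>eq2\<close> leaves size 2.\<close>
  from eq1 eq2 show ?thesis by linarith
qed

text \<open>The pairs inside buckets form a disjoint union of size \<open>t\<close> within the set
  of close pairs. If there are at most \<open>t\<close> close pairs, the two sets coincide, so every
  close pair lies in one bucket.\<close>

lemma
  assumes "finite V" "finite S" "b ` V \<subseteq> S"
    and close: "\<And>u v. u \<in> V \<Longrightarrow> v \<in> V \<Longrightarrow> b u = b v \<Longrightarrow>
      \<bar>int (degree E u) - int (degree E v)\<bar> < int k"
  defines "t \<equiv> \<Sum>s\<in>S. card {v \<in> V. b v = s} choose 2"
  shows h_ge_sum_choose_two: "t \<le> h k V E"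
    and same_fibre_if_h_eq: "\<And>u v. h k V E \<le> t \<Longrightarrow> u \<in> V \<Longrightarrow> v \<in> V \<Longrightarrow> u \<noteq> v \<Longrightarrow>
      \<bar>int (degree E u) - int (degree E v)\<bar> < int k \<Longrightarrow> b u = b v"
proof -
  define F where "F s = {e. e \<subseteq> {v \<in> V. b v = s} \<and> card e = 2}" for s
  define P where "P = {{u, v} | u v. u \<in> V \<and> v \<in> V \<and> u \<noteq> v \<and>
     \<bar>int (degree E u) - int (degree E v)\<bar> < int k}"
  have hP: "h k V E = card P"
    by (simp add: h_def P_def)
  have "P \<subseteq> Pow V"
    by (auto simp: P_def)
  then have finP: "finite P"
    using \<open>finite V\<close> finite_subset by blast
  have finF: "finite (F s)" for s
    using \<open>finite V\<close> by (auto simp: F_def intro!: finite_subset[of _ "Pow V"])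
  have cardF: "card (F s) = card {v \<in> V. b v = s} choose 2" for s
    unfolding F_def using \<open>finite V\<close> by (intro n_subsets) auto
  have "F s \<inter> F s' = {}" if "s \<noteq> s'" for s s'
    using that by (auto simp: F_def card_2_iff)
  then have cardU: "card (\<Union>s\<in>S. F s) = t"
    using \<open>finite S\<close> finF by (subst card_UN_disjoint) (auto simp: t_def cardF)
  have sub: "(\<Union>s\<in>S. F s) \<subseteq> P"
  proof
    fix e assume "e \<in> (\<Union>s\<in>S. F s)"
    then obtain s where s: "e \<subseteq> {v \<in> V. b v = s}" and "card e = 2"
      by (auto simp: F_def)
    then obtain u v where "e = {u, v}" "u \<noteq> v"
      by (auto simp: card_2_iff)
    with s close show "e \<in> P"
      by (auto simp: P_def)
  qed
  show "t \<le> h k V E"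
    using card_mono[OF finP sub] by (simp add: cardU hP)
  fix u v
  assume "h k V E \<le> t" and uv: "u \<in> V" "v \<in> V" "u \<noteq> v"
    "\<bar>int (degree E u) - int (degree E v)\<bar> < int k"
  then have "(\<Union>s\<in>S. F s) = P"
    using card_seteq[OF finP sub] by (simp add: cardU hP)
  moreover have "{u, v} \<in> P"
    using uv by (auto simp: P_def)
  ultimately obtain s where "{u, v} \<in> F s"
    by blast
  then show "b u = b v"
    by (simp add: F_def)
qed

section \<open>Degrees and neighbourhoods\<close>

locale finite_simple_graph =
  fixes V :: "'a set" and E :: "'a set set"
  assumes graph: "simple_graph V E"
begin

lemma finite_V: "finite V"
  using graph by (simp add: simple_graph_def)

lemma degree_eq_card_neighbours: "degree E v = card {w \<in> V. {v, w} \<in> E}"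
proof -
  have "bij_betw (\<lambda>w. {v, w}) {w \<in> V. {v, w} \<in> E} {e \<in> E. v \<in> e}"
  proof (rule bij_betwI')
    fix e assume e: "e \<in> {e \<in> E. v \<in> e}"
    then have "e \<subseteq> V" "card e = 2"
      using graph by (auto simp: simple_graph_def)
    with e show "\<exists>w\<in>{w \<in> V. {v, w} \<in> E}. e = {v, w}"
      by (auto simp: card_2_iff insert_commute)
  qed (auto simp: doubleton_eq_iff)
  then show ?thesis
    by (simp add: degree_def bij_betw_same_card)
qed

lemma not_self_adjacent: "{v, v} \<notin> E"
  using graph by (auto simp: simple_graph_def)

text \<open>The neighbours of \<open>v\<close> and the set \<open>A\<close> are disjoint parts of
  \<open>V - {v}\<close>.\<close>

lemma degree_le_if_nonadjacent:
  assumes "v \<in> V" "A \<subseteq> V" "v \<notin> A" "\<And>w. w \<in> A \<Longrightarrow> {v, w} \<notin> E"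
  shows "degree E v + card A < card V"
proof -
  have "finite A"
    using assms(2) finite_V by (rule finite_subset)
  have "{w \<in> V. {v, w} \<in> E} \<union> A \<subseteq> V - {v}"
    using assms not_self_adjacent[of v] by auto
  then have "card ({w \<in> V. {v, w} \<in> E} \<union> A) \<le> card (V - {v})"
    using finite_V by (intro card_mono) auto
  moreover have "card ({w \<in> V. {v, w} \<in> E} \<union> A) = degree E v + card A"
    using finite_V \<open>finite A\<close> assms by (subst card_Un_disjoint) (auto simp: degree_eq_card_neighbours)
  moreover have "card (V - {v}) < card V"
    using finite_V \<open>v \<in> V\<close> by (rule card_Diff1_less)
  ultimately show ?thesis by linarith
qed

lemma degree_less: "v \<in> V \<Longrightarrow> degree E v < card V"
  using degree_le_if_nonadjacent[of v "{}"] by simp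

lemma card_le_degree:
  assumes "A \<subseteq> V" "\<And>w. w \<in> A \<Longrightarrow> {v, w} \<in> E"
  shows "card A \<le> degree E v"
  unfolding degree_eq_card_neighbours using assms finite_V by (intro card_mono) auto

lemma degree_0_nonadjacent:
  assumes "degree E u = 0" "w \<in> V"
  shows "{u, w} \<notin> E"
  using card_le_degree[of "{w}" u] assms by auto

lemma extreme_degree_missing:
  assumes "1 < card V"
  shows "(\<forall>v\<in>V. degree E v \<noteq> 0) \<or> (\<forall>v\<in>V. degree E v < card V - 1)"
proof (rule ccontr)
  assume "\<not> ?thesis"
  then obtain u v where uv: "u \<in> V" "degree E u = 0" "v \<in> V" "card V - 1 \<le> degree E v"
    by (auto simp: not_less)
  \<comment> \<open>Since \<open>1 < card V\<close>, the degrees 0 and \<open>card V - 1\<close>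
    differ.\<close>
  then have "u \<noteq> v"
    using assms by auto
  then have "degree E v + card {u} < card V"
    using uv degree_0_nonadjacent[of u v]
    by (intro degree_le_if_nonadjacent) (auto simp: insert_commute)
  with uv show False by simp
qed

section \<open>The lower bounds for \<open>k = 1\<close> and \<open>k = 2\<close>\<close>

lemma h_one_ge:
  assumes "1 < card V"
  shows "1 \<le> h 1 V E"
proof -
  \<comment> \<open>Buckets are single degrees; with one extreme value missing,
    \<open>card V - 1\<close> buckets remain.\<close>
  have "\<exists>S::nat set. finite S \<and> card S = card V - 1 \<and> degree E ` V \<subseteq> S"
    using extreme_degree_missing[OF assms]
  proof
    assume *: "\<forall>v\<in>V. degree E v \<noteq> 0"
    then show ?thesis
      using degree_less by (intro exI[of _ "{1..<card V}"]) (auto simp: Suc_le_eq)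
  next
    assume "\<forall>v\<in>V. degree E v < card V - 1"
    then show ?thesis
      by (intro exI[of _ "{..<card V - 1}"]) auto
  qed
  then obtain S :: "nat set" where S: "finite S" "card S = card V - 1" "degree E ` V \<subseteq> S"
    by blast
  have "(\<Sum>s\<in>S. card {v \<in> V. degree E v = s} choose 2) \<le> h 1 V E"
    using finite_V S by (intro h_ge_sum_choose_two) auto
  then show ?thesis
    using sum_choose_two_ge(1)[OF finite_V S(1,3)] S(2) assms by linarith
qed

text \<open>There are \<open>m\<close> buckets of two consecutive degrees, and the steeper bound
  gives 2(2m + 1) - 3m = m + 2.\<close>

lemma h_two_ge_odd:
  assumes "card V = 2 * m + 1" "0 < m"
  shows "m + 2 \<le> h 2 V E"
proof -
  have "\<exists>b. b ` V \<subseteq> {..<m} \<and> (\<forall>u\<in>V. \<forall>v\<in>V. b u = b v \<longrightarrow>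
      \<bar>int (degree E u) - int (degree E v)\<bar> < int 2)"
    using extreme_degree_missing
  proof
    \<comment> \<open>Buckets {1, 2}, ..., {2m - 1, 2m}. Positivity matters: truncated subtraction
      would put degree 0 together with 1 and 2.\<close>
    assume *: "\<forall>v\<in>V. degree E v \<noteq> 0"
    have "(degree E v - 1) div 2 < m" if "v \<in> V" for v
      using degree_less[OF that] assms by linarith
    moreover have "\<bar>int (degree E u) - int (degree E v)\<bar> < int 2"
      if "u \<in> V" "v \<in> V" "(degree E u - 1) div 2 = (degree E v - 1) div 2" for u v
    proof -
      have "degree E u > 0" "degree E v > 0" using * that by auto
      then show ?thesis using that(3) by linarith
    qed
    ultimately show ?thesis
      by (intro exI[of _ "\<lambda>v. (degree E v - 1) div 2"]) blast
  next
    assume *: "\<forall>v\<in>V. degree E v < card V - 1"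
    have "degree E v div 2 < m" if "v \<in> V" for v
      using *[rule_format, OF that] assms by linarith
    moreover have "\<bar>int (degree E u) - int (degree E v)\<bar> < int 2"
      if "degree E u div 2 = degree E v div 2" for u v
      using that by linarith
    ultimately show ?thesis
      by (intro exI[of _ "\<lambda>v. degree E v div 2"]) blast
  qed (use assms in simp)
  then obtain b where b: "b ` V \<subseteq> {..<m}" and close: "\<forall>u\<in>V. \<forall>v\<in>V. b u = b v \<longrightarrow>
      \<bar>int (degree E u) - int (degree E v)\<bar> < int 2"
    by (elim exE conjE)
  have "(\<Sum>s<m. card {v \<in> V. b v = s} choose 2) \<le> h 2 V E"
    by (rule h_ge_sum_choose_two[OF finite_V finite_lessThan b close[rule_format]])
  then show ?thesis
    using sum_choose_two_ge(2)[OF finite_V finite_lessThan b] assms(1) by simp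
qed

lemma h_two_ge_even:
  assumes n: "card V = 2 * m" and "2 \<le> m"
  shows "m + 1 \<le> h 2 V E"
proof (rule ccontr)
  assume "\<not> ?thesis"
  then have h: "h 2 V E \<le> m" by simp
  define b where "b v = degree E v div 2" for v
  let ?t = "\<Sum>s<m. card {v \<in> V. b v = s} choose 2"
  have "b v < m" if "v \<in> V" for v
    unfolding b_def using degree_less[OF that] n by linarith
  then have bV: "b ` V \<subseteq> {..<m}" by auto
  have close: "\<bar>int (degree E u) - int (degree E v)\<bar> < int 2" if "b u = b v" for u v
    using that unfolding b_def by linarith
  have t: "?t \<le> h 2 V E"
    by (rule h_ge_sum_choose_two[OF finite_V finite_lessThan bV close])
  moreover have "m \<le> ?t"
    using sum_choose_two_ge(2)[OF finite_V finite_lessThan bV] n by simp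
  ultimately have t_eq: "?t = m" "h 2 V E \<le> ?t"
    using h by linarith+
  have same: "b u = b v" if "u \<in> V" "v \<in> V" "u \<noteq> v"
    "\<bar>int (degree E u) - int (degree E v)\<bar> < int 2" for u v
    using same_fibre_if_h_eq[OF finite_V finite_lessThan bV close t_eq(2) that] .
  have fibre: "\<exists>x y. x \<noteq> y \<and> {v \<in> V. b v = j} = {x, y}" if "j < m" for j
  proof -
    have "card {v \<in> V. b v = j} = 2"
      using finite_V bV n t_eq(1) that by (intro card_fibre_eq_2[of V "{..<m}"]) auto
    then show ?thesis by (auto simp: card_2_iff)
  qed
  obtain u v where uv: "u \<noteq> v" "{v \<in> V. b v = 0} = {u, v}"
    using fibre[of 0] assms by auto
  obtain x y where xy: "x \<noteq> y" "{v \<in> V. b v = m - 1} = {x, y}"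
    using fibre[of "m - 1"] assms by auto
  have high: "z \<in> V \<and> 2 * m - 2 \<le> degree E z" if "z \<in> {x, y}" for z
    using that unfolding xy(2)[symmetric] b_def by auto
  have low: "z \<in> V \<and> degree E z \<le> 1" if "z \<in> {u, v}" for z
    using that unfolding uv(2)[symmetric] b_def by auto
  \<comment> \<open>Low degrees are at most 1 and high ones at least 2m - 2, which exceeds 1 as
    \<open>2 \<le> m\<close>.\<close>
  have apart: "w \<noteq> z" if "w \<in> {u, v}" "z \<in> {x, y}" for w z
    using that high low \<open>2 \<le> m\<close> by fastforce
  have no_common: "\<exists>z\<in>{x, y}. {z, w} \<notin> E" if "w \<in> {u, v}" for w
  proof (rule ccontr)
    assume "\<not> ?thesis"
    then have "card {x, y} \<le> degree E w"
      using high by (intro card_le_degree) (auto simp: insert_commute)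
    with low[OF that] xy(1) show False by simp
  qed
  have low_odd: "odd (degree E w)" if w: "w \<in> {u, v}" for w
  proof
    assume "even (degree E w)"
    then have "degree E w = 0"
      using low[OF w] by (cases "degree E w") auto
    obtain w' where w': "w' \<in> {u, v}" "w' \<noteq> w"
      using w uv(1) by auto
    obtain z where z: "z \<in> {x, y}" "{z, w'} \<notin> E"
      using no_common[OF w'(1)] by blast
    \<comment> \<open>Now \<open>z\<close> misses both \<open>w\<close> and \<open>w'\<close>, which
      pushes its degree below 2m - 2.\<close>
    have "{z, w} \<notin> E"
      using degree_0_nonadjacent[OF \<open>degree E w = 0\<close>] high[OF z(1)]
      by (metis insert_commute)
    then have "degree E z + card {w, w'} < card V"
      using z(2) high[OF z(1)] low[OF w] low[OF w'(1)] apart[OF w z(1)] apart[OF w'(1) z(1)]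
      by (intro degree_le_if_nonadjacent) auto
    moreover have "card {w, w'} = 2"
      using w'(2) by auto
    ultimately show False
      using high[OF z(1)] n by linarith
  qed
  have odd: "\<forall>w\<in>V. b w = j \<longrightarrow> odd (degree E w)" if "j < m" for j
    using that
  proof (induction j)
    case 0
    then show ?case using low_odd uv(2) by blast
  next
    case (Suc j)
    obtain a where a: "a \<in> V" "b a = j"
      using fibre[of j] Suc.prems by auto
    then have "odd (degree E a)" using Suc by simp
    show ?case
    proof (intro ballI impI notI)
      \<comment> \<open>An even degree in this bucket is 2j + 2, one more than the odd degree of
        \<open>a\<close>: a close pair across two buckets.\<close>
      fix w assume w: "w \<in> V" "b w = Suc j" "even (degree E w)"
      have "degree E a = 2 * j + 1" "degree E w = 2 * j + 2"
        using a w \<open>odd (degree E a)\<close> unfolding b_def by presburger+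
      then have "b a = b w"
        using a w by (intro same) auto
      with a w show False by simp
    qed
  qed
  \<comment> \<open>Odd degree in the top bucket means 2m - 1, adjacency to all other vertices, yet
    \<open>z\<close> misses \<open>u\<close>.\<close>
  obtain z where z: "z \<in> {x, y}" "{z, u} \<notin> E"
    using no_common[of u] by blast
  then have "odd (degree E z)" "b z = m - 1"
    using odd[of "m - 1"] xy(2) \<open>2 \<le> m\<close> by auto
  then have "degree E z = 2 * m - 1"
    unfolding b_def using \<open>2 \<le> m\<close> by presburger
  moreover have "degree E z + card {u} < card V"
    using z(2) high[OF z(1)] low[of u] apart[of u z] z(1)
    by (intro degree_le_if_nonadjacent) auto
  ultimately show False using n by simp
qed

end

theorem theorem2:
  fixes k n :: nat and V :: "'a set" and E :: "'a set set"
  assumes "1 \<le> k" and "k \<le> 2" and "k < n"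
    and "simple_graph V E" and "card V = n"
  shows "real (h k V E) \<ge> f0 n k"
proof -
  interpret finite_simple_graph V E
    using assms(4) by unfold_locales
  consider "k = 1" | m where "k = 2" "n = 2 * m" | m where "k = 2" "n = 2 * m + 1"
  proof -
    from assms(1,2) have "k = 1 \<or> k = 2" by linarith
    moreover have "n = 2 * (n div 2) \<or> n = 2 * (n div 2) + 1" by presburger
    ultimately show thesis using that by blast
  qed
  then show ?thesis
  proof cases
    case 1
    then show ?thesis
      using h_one_ge f0_one[of n] assms by simp
  next
    case 2
    then show ?thesis
      using h_two_ge_even[of m] assms by (simp add: f0_two_even)
  next
    case 3
    then have "m + 2 \<le> h 2 V E"
      using h_two_ge_odd[of m] assms by simp
    then show ?thesis
      using 3 f0_two_odd[of m] by simp
  qed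
qed

end
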